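(* For every integer $i\ge1$ and all $t\ne0$, $$\biggl(\frac1{1-e^{-t}}\biggr)^{(i)}=\sum_{m=1}^{i+1}\frac{\lambda_{i,m}}{(e^t-1)^m},$$ where $\lambda_{i,m}=(-1)^i(m-1)!\,S(i+1,m)$ for $1\le m\le i+1$.
   Context: $t$ is a real variable. For a function $f$ of $t$, $f^{(n)}$ denotes the $n$-th derivative with respect to $t$. For $1\le m\le n$, $S(n,m)=\frac1{m!}\sum_{\ell=0}^m(-1)^{m-\ell}\binom{m}{\ell}\ell^{n}$ are the Stirling numbers of the second kind. *)

theory Defs
  imports "HOL-Analysis.Analysis" "HOL-Combinatorics.Stirling"
begin

definition stirling2 :: "nat \<Rightarrow> nat \<Rightarrow> real" where
  "stirling2 n m =
     1 / fact m * (\<Sum>l=0..m. (-1) ^ (m - l) * real (m choose l) * real l ^ n)"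

definition lambda_coeff :: "nat \<Rightarrow> nat \<Rightarrow> real" where
  "lambda_coeff i m = (-1) ^ i * fact (m - 1) * stirling2 (i + 1) m"

text \<open>The explicit formula agrees with the recursively defined numbers \<^const>\<open>Stirling\<close>.\<close>

lemma stirling2_Suc_Suc:
  "stirling2 (Suc n) (Suc m) = real (Suc m) * stirling2 n (Suc m) + stirling2 n m"
proof -
  define a where "a n m = (\<Sum>l=0..m. (-1) ^ (m - l) * real (m choose l) * real l ^ n)"
    for n m :: nat
  have absorb: "real l * real (Suc m choose l) = real (Suc m) * (real (Suc m choose l) - real (m choose l))"
    for l
  proof (cases l)
    case (Suc k)
    have "real (Suc k * (Suc m choose Suc k)) = real (Suc m * (m choose k))"
      by (simp only: Suc_times_binomial)
    then show ?thesis using Suc by (simp add: algebra_simps)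
  qed simp
  have "a (Suc n) (Suc m) =
      (\<Sum>l=0..Suc m. real (Suc m) * ((-1) ^ (Suc m - l) * real (Suc m choose l) * real l ^ n)
         - real (Suc m) * ((-1) ^ (Suc m - l) * real (m choose l) * real l ^ n))"
    unfolding a_def
  proof (rule sum.cong[OF refl])
    fix l
    have "(-1) ^ (Suc m - l) * real (Suc m choose l) * real l ^ Suc n
        = (-1) ^ (Suc m - l) * real l ^ n * (real l * real (Suc m choose l))"
      by (simp only: power_Suc ac_simps)
    also have "\<dots> = (-1) ^ (Suc m - l) * real l ^ n *
        (real (Suc m) * (real (Suc m choose l) - real (m choose l)))"
      by (simp only: absorb)
    finally show "(-1) ^ (Suc m - l) * real (Suc m choose l) * real l ^ Suc n =
        real (Suc m) * ((-1) ^ (Suc m - l) * real (Suc m choose l) * real l ^ n)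
         - real (Suc m) * ((-1) ^ (Suc m - l) * real (m choose l) * real l ^ n)"
      by (simp only: right_diff_distrib ac_simps)
  qed
  also have "\<dots> = real (Suc m) * a n (Suc m)
      - real (Suc m) * (\<Sum>l=0..Suc m. (-1) ^ (Suc m - l) * real (m choose l) * real l ^ n)"
    by (simp only: a_def sum_subtractf sum_distrib_left)
  also have "(\<Sum>l=0..Suc m. (-1) ^ (Suc m - l) * real (m choose l) * real l ^ n) = - a n m"
  proof -
    have "(\<Sum>l=0..Suc m. (-1) ^ (Suc m - l) * real (m choose l) * real l ^ n)
        = (\<Sum>l=0..m. (-1) ^ (Suc m - l) * real (m choose l) * real l ^ n)"
      by simp
    also have "\<dots> = (\<Sum>l=0..m. - ((-1) ^ (m - l) * real (m choose l) * real l ^ n))"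
      by (rule sum.cong) (auto simp: Suc_diff_le)
    finally show ?thesis by (simp add: a_def sum_negf)
  qed
  finally have *: "a (Suc n) (Suc m) = real (Suc m) * (a n (Suc m) + a n m)"
    by (simp add: algebra_simps)
  have st: "stirling2 n m = a n m / fact m" for n m
    by (simp add: stirling2_def a_def)
  have "stirling2 (Suc n) (Suc m) = (a n (Suc m) + a n m) / fact m"
    by (simp add: st * del: of_nat_Suc)
  also have "\<dots> = real (Suc m) * stirling2 n (Suc m) + stirling2 n m"
    by (simp add: st add_divide_distrib del: of_nat_Suc)
  finally show ?thesis .
qed

lemma stirling2_eq_Stirling: "stirling2 n m = real (Stirling n m)"
proof (induction n m rule: Stirling.induct)
  case (2 k)
  have "(\<Sum>l=0..Suc k. (-1) ^ (Suc k - l) * real (Suc k choose l)) = (1 + (-1 :: real)) ^ Suc k"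
    by (subst binomial_ring) (simp add: atMost_atLeast0 mult.commute)
  then show ?case by (simp add: stirling2_def)
next
  case (4 n k)
  then show ?case by (simp add: stirling2_Suc_Suc algebra_simps)
qed (simp_all add: stirling2_def)

end

theory Submission
  imports Defs
begin

text \<open>
  Put \<open>q t = 1 / (exp t - 1)\<close>, so that \<open>1 / (1 - exp (- t)) = 1 + q t\<close> away from zero.  Since
  \<open>exp t = 1 + 1 / q t\<close>, the function \<open>q\<close> solves the Riccati equation \<open>q' = - (q + q\<^sup>2)\<close>, whence
  \<open>(q ^ m)' = - m (q ^ m + q ^ (m + 1))\<close>.  Differentiating a polynomial in \<open>q\<close> with coefficients
  \<open>c m\<close> therefore gives a polynomial in \<open>q\<close> with coefficients \<open>- (m c m + (m - 1) c (m - 1))\<close>.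
  For \<open>c m = (-1) ^ i * fact (m - 1) * S(i + 1, m)\<close> this is the triangular recurrence of the
  Stirling numbers of the second kind, multiplied by \<open>(-1) ^ (i + 1) * fact (m - 1)\<close>
  (\<open>lambda_coeff_Suc_Suc\<close>).  So the right-hand sides form a chain in which each is the derivative of
  the one before it (\<open>has_derivative_lambda_sum\<close>).  The chain starts at order zero with \<open>q\<close> itself,
  which differs from the given function by the constant 1.
\<close>

text \<open>
  The degenerate value \<open>m = 0\<close> fits the recurrence because \<open>S(i + 1, 0) = 0\<close>; so the lowest
  coefficient of a derivative needs no special case.
\<close>

lemma lambda_coeff_Suc_Suc:
  "lambda_coeff (Suc i) (Suc m) =
     - (real (Suc m) * lambda_coeff i (Suc m) + real m * lambda_coeff i m)"
proof (cases m)
  case 0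
  then show ?thesis
    by (simp add: lambda_coeff_def stirling2_eq_Stirling)
next
  case (Suc k)
  then show ?thesis
    by (simp add: lambda_coeff_def stirling2_Suc_Suc algebra_simps)
qed

lemma lambda_coeff_eq_0: "i + 1 < m \<Longrightarrow> lambda_coeff i m = 0"
  by (simp add: lambda_coeff_def stirling2_eq_Stirling)

lemma has_derivative_inverse_exp_minus_one_power:
  fixes t :: real
  assumes "t \<noteq> 0"
  shows "((\<lambda>x. c / (exp x - 1) ^ m) has_real_derivative
           - (real m * c / (exp t - 1) ^ m + real m * c / (exp t - 1) ^ Suc m)) (at t)"
proof -
  have nz: "exp t - 1 \<noteq> 0"
    using assms by simp
  show ?thesis
  proof (cases m)
    case (Suc k)
    have "((\<lambda>x. c / (exp x - 1) ^ m) has_real_derivative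
            - (c * (real m * (exp t - 1) ^ k * exp t)) / ((exp t - 1) ^ m * (exp t - 1) ^ m)) (at t)"
      by (rule derivative_eq_intros refl | use nz Suc in simp)+
    also have "- (c * (real m * (exp t - 1) ^ k * exp t)) / ((exp t - 1) ^ m * (exp t - 1) ^ m)
        = - (real m * c / (exp t - 1) ^ m + real m * c / (exp t - 1) ^ Suc m)"
    proof -
      have "- (c * (r * y ^ k * (y + 1))) / (y ^ m * y ^ m) = - (r * c / y ^ m + r * c / y ^ Suc m)"
        if "y \<noteq> 0" for r y :: real
        using that by (simp add: Suc divide_simps) (simp add: algebra_simps)
      from this[OF nz, of "real m"] show ?thesis
        by simp
    qed
    finally show ?thesis .
  qed simp
qed

lemma has_derivative_lambda_sum:
  fixes t :: real
  assumes "t \<noteq> 0"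
  shows "((\<lambda>x. \<Sum>m=1..i+1. lambda_coeff i m / (exp x - 1) ^ m) has_real_derivative
           (\<Sum>m=1..Suc i+1. lambda_coeff (Suc i) m / (exp t - 1) ^ m)) (at t)"
proof -
  define y where "y = exp t - 1"
  let ?g = "\<lambda>m. real m * lambda_coeff i m / y ^ m"
  let ?h = "\<lambda>m. real m * lambda_coeff i m / y ^ Suc m"
  have "((\<lambda>x. \<Sum>m=1..i+1. lambda_coeff i m / (exp x - 1) ^ m) has_real_derivative
           (\<Sum>m=1..i+1. - (?g m + ?h m))) (at t)"
    unfolding y_def
    by (intro DERIV_sum has_derivative_inverse_exp_minus_one_power assms)
  moreover have "(\<Sum>m=1..Suc i+1. lambda_coeff (Suc i) m / y ^ m) = (\<Sum>m=1..i+1. - (?g m + ?h m))"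
  proof -
    have "(\<Sum>m=1..Suc i+1. lambda_coeff (Suc i) m / y ^ m)
        = (\<Sum>m=0..i+1. lambda_coeff (Suc i) (Suc m) / y ^ Suc m)"
      using sum.shift_bounds_cl_Suc_ivl[of "\<lambda>m. lambda_coeff (Suc i) m / y ^ m" 0 "i+1"] by simp
    also have "\<dots> = (\<Sum>m=0..i+1. - (?g (Suc m) + ?h m))"
      by (intro sum.cong refl)
         (simp only: lambda_coeff_Suc_Suc minus_divide_left[symmetric] add_divide_distrib)
    also have "\<dots> = - ((\<Sum>m=0..i+1. ?g (Suc m)) + (\<Sum>m=0..i+1. ?h m))"
      by (simp only: sum_negf sum.distrib)
    also have "(\<Sum>m=0..i+1. ?g (Suc m)) = (\<Sum>m=1..i+2. ?g m)"
      using sum.shift_bounds_cl_Suc_ivl[of ?g 0 "i+1"] by simp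
    \<comment> \<open>The top term vanishes with \<open>S(i + 1, i + 2)\<close>.\<close>
    also have "\<dots> = (\<Sum>m=1..i+1. ?g m)"
      by (simp add: lambda_coeff_eq_0)
    also have "(\<Sum>m=0..i+1. ?h m) = (\<Sum>m=1..i+1. ?h m)"
      by (simp add: sum.atLeast_Suc_atMost)
    finally show ?thesis
      by (simp only: sum_negf sum.distrib)
  qed
  ultimately show ?thesis
    by (simp only: y_def)
qed

text \<open>
  Indexed by the order \<open>i\<close> of the function being differentiated, the formula holds from \<open>i = 0\<close> on
  although \<open>f\<close> itself carries the extra constant 1: differentiation removes it.  The induction needs
  the claim at all nonzero points at once, since a derivative depends on the function near the point
  and the identity for the lower order has to be available on the open set \<open>- {0}\<close>.
\<close>

lemma has_derivative_iterated_deriv: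
  fixes t :: real
  assumes "t \<noteq> 0"
  shows "((deriv ^^ i) (\<lambda>x::real. 1 / (1 - exp (- x))) has_real_derivative
           (\<Sum>m=1..Suc i+1. lambda_coeff (Suc i) m / (exp t - 1) ^ m)) (at t)"
  using assms
proof (induction i arbitrary: t)
  case 0
  have "((\<lambda>x. 1 + (\<Sum>m=1..0+1. lambda_coeff 0 m / (exp x - 1) ^ m)) has_real_derivative
          (\<Sum>m=1..Suc 0+1. lambda_coeff (Suc 0) m / (exp t - 1) ^ m)) (at t)"
    using DERIV_add[OF DERIV_const has_derivative_lambda_sum[OF 0, of 0]] by simp
  moreover have "1 + (\<Sum>m=1..0+1. lambda_coeff 0 m / (exp x - 1) ^ m) = 1 / (1 - exp (- x))"
    if "x \<in> - {0}" for x :: real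
    using that by (simp add: lambda_coeff_def stirling2_eq_Stirling exp_minus field_simps)
  ultimately show ?case
    using 0 by (auto intro: has_field_derivative_transform_within_open[where S = "- {0}"])
next
  case (Suc i)
  have eq: "(\<Sum>m=1..Suc i+1. lambda_coeff (Suc i) m / (exp x - 1) ^ m)
      = (deriv ^^ Suc i) (\<lambda>x::real. 1 / (1 - exp (- x))) x" if "x \<in> - {0}" for x
    using DERIV_imp_deriv[OF Suc.IH[of x]] that by simp
  have "open (- {0::real})" "t \<in> - {0}"
    using Suc.prems by auto
  then show ?case
    by (rule has_field_derivative_transform_within_open
        [OF has_derivative_lambda_sum[OF Suc.prems] _ _ eq])
qed

theorem corollary2p1:
  fixes i :: nat and t :: real
  assumes "i \<ge> 1" and "t \<noteq> 0"
  shows "(\<forall>j<i. (deriv ^^ j) (\<lambda>x::real. 1 / (1 - exp (- x))) differentiable (at t)) \<and>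
         (deriv ^^ i) (\<lambda>x::real. 1 / (1 - exp (- x))) t =
           (\<Sum>m=1..i+1. lambda_coeff i m / (exp t - 1) ^ m)"
proof (intro conjI allI impI)
  fix j
  show "(deriv ^^ j) (\<lambda>x::real. 1 / (1 - exp (- x))) differentiable (at t)"
    using has_derivative_iterated_deriv[OF assms(2)] real_differentiable_def by blast
next
  obtain k where "i = Suc k"
    using assms(1) by (cases i) auto
  then show "(deriv ^^ i) (\<lambda>x::real. 1 / (1 - exp (- x))) t =
      (\<Sum>m=1..i+1. lambda_coeff i m / (exp t - 1) ^ m)"
    using DERIV_imp_deriv[OF has_derivative_iterated_deriv[OF assms(2), of k]] by simp
qed

end
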